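(* Let $n,m\ge 1$ and $i\ge 0$ be integers, and set $r_0:=n$, $j_0:=i$. For integers $r\ge1$, $p\ge 1$, $j\ge 0$ put \[ t_{r,p,j}:=-\sum_{s=1}^{r}\frac{\zeta(s+1,\{1\}_{p-1})}{(j+1)^{r+1-s}}+\frac{\zeta^\star_{j+1}(\{1\}_p)}{(j+1)^{r+1}}. \] Then \begin{align*} S_{n,m}^{(i)}&=\sum_{h=1}^{m-1}\ \sum_{\substack{n\ge r_1\ge\cdots\ge r_h\ge1\\ i\ge j_1\ge\cdots\ge j_h\ge 0}}\frac{t_{r_h,m-h,j_h}}{\prod_{k=0}^{h-1}(j_k+1)^{r_k+1-r_{k+1}}}\\ &\quad+\sum_{\substack{n\ge r_1\ge\cdots\ge r_m\ge1\\ i\ge j_1\ge\cdots\ge j_m\ge 0}}\frac{1}{\Big(\prod_{k=0}^{m-1}(j_k+1)^{r_k+1-r_{k+1}}\Big)(j_m+1)^{r_m+1}}+t_{n,m,i}. \end{align*}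
   Context: $S_{n,m}^{(i)}:=\frac{(-1)^{n+m}}{n!\,m!}\int_0^1 x^i\ln^n(x)\ln^m(1-x)\,dx$. $\zeta(s+1,\{1\}_{p-1})=\sum_{\ell_1>\cdots>\ell_p\ge1}\frac{1}{\ell_1^{s+1}\ell_2\cdots\ell_p}$. For integers $N,k\ge0$, $\zeta^{\star}_N(\{1\}_k)=\sum_{N\ge \ell_1\ge\cdots\ge \ell_k\ge 1}\frac{1}{\ell_1\cdots\ell_k}$. *)

theory Defs
  imports "HOL-Analysis.Analysis"
begin

(* The value ln 0 = 0 chosen at the endpoints does not affect the integral. *)
definition S_int :: "nat \<Rightarrow> nat \<Rightarrow> nat \<Rightarrow> real" where
  "S_int n m i = (-1) ^ (n + m) / (fact n * fact m) *
     integral {0..1} (\<lambda>x::real. x ^ i * ln x ^ n * ln (1 - x) ^ m)"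

(* Multiple zeta value with l_1 > l_2 > ... : the first entry of the index list
   is the exponent of the largest summation variable. *)
definition multi_zeta :: "nat list \<Rightarrow> real" where
  "multi_zeta ss =
     (\<Sum>\<^sub>\<infinity>ls\<in>{ls :: nat list. length ls = length ss \<and> sorted_wrt (>) ls \<and> set ls \<subseteq> {1..}}.
        (\<Prod>k<length ss. 1 / real (ls ! k) ^ (ss ! k)))"

definition weak_decr :: "nat \<Rightarrow> nat \<Rightarrow> nat \<Rightarrow> nat list set" where
  "weak_decr lo hi k = {as. length as = k \<and> sorted_wrt (\<ge>) as \<and> set as \<subseteq> {lo..hi}}"

definition zeta_star_ones :: "nat \<Rightarrow> nat \<Rightarrow> real" where
  "zeta_star_ones N k = (\<Sum>ls\<in>weak_decr 1 N k. 1 / (\<Prod>a<k. real (ls ! a)))"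

definition t_coeff :: "nat \<Rightarrow> nat \<Rightarrow> nat \<Rightarrow> real" where
  "t_coeff r p j =
     - (\<Sum>s=1..r. multi_zeta ((s + 1) # replicate (p - 1) 1) / real (j + 1) ^ (r + 1 - s))
     + zeta_star_ones (j + 1) p / real (j + 1) ^ (r + 1)"

(* Both lists carry their initial entries r_0 and j_0 at position 0; for weakly
   decreasing r the exponent r_k + 1 - r_{k+1} is positive, without truncation. *)
definition chain_prod :: "nat list \<Rightarrow> nat list \<Rightarrow> nat \<Rightarrow> real" where
  "chain_prod r j h = (\<Prod>k<h. real (j ! k + 1) ^ (r ! k + 1 - r ! (k + 1)))"

end

theory Submission
  imports Defs
begin

text \<open>
  Expanding $(-\ln(1-x))^m/m!$ into its power series with coefficients $c_m(l)$ and integrating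
  termwise gives $S_{n,m}^{(i)} = \sum_l c_m(l)/(l+i+1)^{n+1}$; likewise
  $\zeta(s+1,\{1\}_{p-1}) = \sum_l c_p(l)/l^s$. Since $l\,c_{m+1}(l) = \sum_{k<l} c_m(k)$,
  exchanging summations and telescoping yields
  \[ \sum_l l\,c_{m+1}(l)\Big(\frac1{l^{n+1}} - \frac1{(l+i+1)^{n+1}}\Big)
       = \sum_{j=0}^i S_{n,m}^{(j)}. \]
  Rewriting the left-hand side gives a recurrence in $n$ whose solution is
  $S_{n,m+1}^{(i)} = t_{n,m+1,i} + \sum_{r=1}^n\sum_{j=0}^i S_{r,m}^{(j)}/(i+1)^{n+1-r}$,
  and the theorem is the $m$-fold iteration of this identity.
\<close>

text \<open>The coefficient of $x^l$ in $(-\ln(1-x))^m/m!$; at \<open>l = 0\<close> the division by zero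
  in the second equation gives the correct value \<open>0\<close>.\<close>

fun log_coeff :: "nat \<Rightarrow> nat \<Rightarrow> real" where
  "log_coeff 0 l = (if l = 0 then 1 else 0)"
| "log_coeff (Suc m) l = (\<Sum>k<l. log_coeff m k) / real l"

text \<open>The shift q lets one family serve both kinds of values: q = i + 1 gives the integrals
  and q = 0 the zeta values. For q = 0 the term at l = 0 is 0 by division by zero.\<close>

definition log_sum :: "nat \<Rightarrow> nat \<Rightarrow> nat \<Rightarrow> real" where
  "log_sum m n q = (\<Sum>l. log_coeff m l / real (l + q) ^ Suc n)"

section \<open>Size of the coefficients and convergence of \<open>log_sum\<close>\<close>

lemma log_coeff_nonneg: "0 \<le> log_coeff m l"
  by (induction m arbitrary: l) (auto intro!: divide_nonneg_nonneg sum_nonneg)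

lemma sum_inverse_sqrt_le: "(\<Sum>k<l. 1 / sqrt (real (k + 1))) \<le> 2 * sqrt (real l)"
proof (induction l)
  case (Suc l)
  define a b where "a = sqrt (real l)" and "b = sqrt (real (l + 1))"
  have ab: "0 \<le> a" "0 < b" "b * b = a * a + 1"
    by (auto simp: a_def b_def)
  \<comment> \<open>Inserting a^2 = b^2 - 1 turns this square into 1 \<le> 2 b (b - a), the bound
    for the new summand.\<close>
  have "0 \<le> (b - a)\<^sup>2" by simp
  then have "1 / b \<le> 2 * b - 2 * a"
    using ab by (simp add: field_simps power2_eq_square)
  with Suc show ?case
    by (simp add: a_def b_def add.commute)
qed simp

text \<open>The decay l^(-1/2) is crude but reproduces itself: its partial sums are O(l^(1/2)), and
  the recursion divides by l. Of the factor 4, one 2 comes from \<open>sum_inverse_sqrt_le\<close>,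
  the other from passing from l to l + 1 under the root.\<close>

lemma log_coeff_le: "log_coeff m l \<le> 4 ^ m / sqrt (real (l + 1))"
proof (induction m arbitrary: l)
  case (Suc m)
  show ?case
  proof (cases "l = 0")
    case False
    have "(\<Sum>k<l. log_coeff m k) \<le> (\<Sum>k<l. 4 ^ m * (1 / sqrt (real (k + 1))))"
      using Suc by (intro sum_mono) simp
    also have "\<dots> \<le> 4 ^ m * (2 * sqrt (real l))"
      unfolding sum_distrib_left[symmetric]
      by (intro mult_left_mono sum_inverse_sqrt_le) simp
    finally have "log_coeff (Suc m) l \<le> 4 ^ m * (2 * sqrt (real l)) / real l"
      using False by (simp add: divide_right_mono)
    also have "\<dots> = 4 ^ m * (2 / sqrt (real l))"
      using False real_div_sqrt[of "real l"] by (simp add: field_simps)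
    also have "2 / sqrt (real l) \<le> 4 / sqrt (real (l + 1))"
    proof -
      have "sqrt (real (l + 1)) \<le> sqrt (4 * real l)"
        using False by (intro real_sqrt_le_mono) simp
      then show ?thesis
        using False by (simp add: real_sqrt_mult field_simps)
    qed
    finally show ?thesis by (simp add: mult.commute)
  qed simp
qed simp

text \<open>A single factor of the denominator suffices: with \<open>log_coeff_le\<close> it gives
  the majorant l^(-3/2), also for n = 0.\<close>

lemma summable_log_sum: "summable (\<lambda>l. log_coeff m l / real (l + q) ^ Suc n)"
proof (rule summable_comparison_test')
  show "summable (\<lambda>l. 4 ^ m * (real l powr (-3/2)))"
    by (intro summable_mult) (simp add: summable_real_powr_iff)
next
  fix l :: nat assume l: "1 \<le> l"
  have "log_coeff m l / real (l + q) ^ Suc n \<le> (4 ^ m / sqrt (real (l + 1))) / real (l + q) ^ Suc n"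
    by (intro divide_right_mono log_coeff_le) simp
  also have "\<dots> \<le> (4 ^ m / sqrt (real l)) / real l"
  proof (intro frac_le)
    have "real l \<le> real (l + q)" by simp
    also have "\<dots> \<le> real (l + q) ^ Suc n"
      using l by (intro self_le_power) auto
    finally show "real l \<le> real (l + q) ^ Suc n" .
  qed (use l in auto)
  also have "\<dots> = 4 ^ m * (real l powr (-3/2))"
  proof -
    have "real l powr (-3/2) = real l powr (-(1/2)) * real l powr (-1)"
      unfolding powr_add[symmetric] by simp
    then show ?thesis
      using l by (simp add: powr_minus powr_half_sqrt field_simps)
  qed
  finally show "norm (log_coeff m l / real (l + q) ^ Suc n) \<le> 4 ^ m * (real l powr (-3/2))"
    using log_coeff_nonneg[of m l] by simp
qed

lemma log_sum_sums: "(\<lambda>l. log_coeff m l / real (l + q) ^ Suc n) sums log_sum m n q"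
  unfolding log_sum_def using summable_log_sum by (rule summable_sums)

section \<open>Exchange of summations and the recurrences for \<open>log_sum\<close>\<close>

text \<open>The difference splits into i + 1 consecutive differences, and each of them telescopes in
  l to its initial value.\<close>

lemma sums_shift_diff:
  fixes F :: "nat \<Rightarrow> real"
  assumes "F \<longlonglongrightarrow> 0"
  shows "(\<lambda>l. F (l + k) - F (l + k + Suc i)) sums (\<Sum>j=0..i. F (k + j))"
proof -
  have "(\<lambda>l. F (l + (k + j)) - F (Suc l + (k + j))) sums F (k + j)" for j
    using telescope_sums'[OF LIMSEQ_ignore_initial_segment[OF assms, of "k + j"]] by simp
  then have "(\<lambda>l. \<Sum>j=0..i. F (l + (k + j)) - F (Suc l + (k + j))) sums (\<Sum>j=0..i. F (k + j))"
    by (intro sums_sum)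
  moreover have "(\<Sum>j=0..i. F (l + (k + j)) - F (Suc l + (k + j))) = F (l + k) - F (l + k + Suc i)" for l
    by (induction i) (auto simp: add_ac)
  ultimately show ?thesis by simp
qed

text \<open>Tonelli over the pairs k < l: summing over l first gives the terms
  \<open>c k * T k\<close>, summing over k first gives the conclusion. The restriction to positive l
  in the sign condition matters, since in the application \<open>g 0\<close> is negative because 1 /
  0 = 0.\<close>

lemma sums_sum_lessThan_mult:
  fixes c g T :: "nat \<Rightarrow> real"
  assumes c: "\<And>k. 0 \<le> c k" and g: "\<And>l. 0 < l \<Longrightarrow> 0 \<le> g l"
    and T: "\<And>k. (\<lambda>l. g (l + Suc k)) sums T k"
    and S: "(\<lambda>k. c k * T k) sums S"
  shows "(\<lambda>l. (\<Sum>k<l. c k) * g l) sums S"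
proof -
  have T_nonneg: "0 \<le> T k" for k
    using sums_le[OF _ sums_zero T[of k]] g by simp
  have inner: "((\<lambda>l. c k * g l) has_sum c k * T k) {Suc k..}" for k
  proof -
    have "((\<lambda>l. g (l + Suc k)) has_sum T k) UNIV"
      using T g by (intro sums_nonneg_imp_has_sum) auto
    then have "(g has_sum T k) {Suc k..}"
      by (subst has_sum_reindex_bij_witness[where i = "\<lambda>l. l + Suc k" and j = "\<lambda>l. l - Suc k"
            and T = UNIV and h = "\<lambda>l. g (l + Suc k)" and s' = "T k"]) auto
    then show ?thesis by (rule has_sum_cmult_right)
  qed
  have outer: "((\<lambda>k. c k * T k) has_sum S) UNIV"
    using S c T_nonneg by (intro sums_nonneg_imp_has_sum) auto
  have "((\<lambda>(k, l). c k * g l) has_sum S) (Sigma UNIV (\<lambda>k. {Suc k..}))"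
  proof (rule has_sum_SigmaI[OF _ outer])
    show "(\<lambda>(k, l). c k * g l) summable_on Sigma UNIV (\<lambda>k. {Suc k..})"
    proof (rule summable_on_SigmaI)
      show "(\<lambda>k. c k * T k) summable_on UNIV"
        using outer by (rule has_sum_imp_summable)
    qed (use inner c g in auto)
  qed (use inner in simp)
  then have "((\<lambda>(l, k). c k * g l) has_sum S) (Sigma UNIV (\<lambda>l. {..<l}))"
    by (subst has_sum_reindex_bij_witness[where i = prod.swap and j = prod.swap
          and T = "Sigma UNIV (\<lambda>k. {Suc k..})" and h = "\<lambda>(k, l). c k * g l" and s' = S]) auto
  then have "((\<lambda>l. \<Sum>k<l. c k * g l) has_sum S) UNIV"
    by (rule has_sum_SigmaD) auto
  then show ?thesis
    by (simp add: has_sum_imp_sums sum_distrib_right)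
qed

lemma tendsto_inverse_power_nat: "(\<lambda>l. 1 / real l ^ Suc n) \<longlonglongrightarrow> 0"
proof -
  have "(\<lambda>l. (1 / real l) ^ Suc n) \<longlonglongrightarrow> 0 ^ Suc n"
    by (intro tendsto_power lim_1_over_n)
  then show ?thesis by (simp add: power_divide)
qed

text \<open>The factor l cancels the division in \<open>log_coeff\<close>, leaving partial sums of
  \<open>log_coeff m\<close> to which the exchange applies; the inner sums over l > k telescope to
  the sum of 1 / (k + j + 1)^(n + 1) over j \<le> i.\<close>

lemma sums_weighted_log_coeff:
  "(\<lambda>l. real l * log_coeff (Suc m) l * (1 / real l ^ Suc n - 1 / real (l + Suc i) ^ Suc n))
     sums (\<Sum>j=0..i. log_sum m n (j + 1))"
proof -
  let ?F = "\<lambda>l. 1 / real l ^ Suc n"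
  have "(\<lambda>l. (\<Sum>k<l. log_coeff m k) * (?F l - ?F (l + Suc i)))
          sums (\<Sum>j=0..i. log_sum m n (j + 1))"
  proof (rule sums_sum_lessThan_mult)
    show "0 \<le> ?F l - ?F (l + Suc i)" if "0 < l" for l
    proof -
      have "real l ^ Suc n \<le> real (l + Suc i) ^ Suc n"
        by (intro power_mono) auto
      then have "?F (l + Suc i) \<le> ?F l"
        using that by (intro divide_left_mono) auto
      then show ?thesis by simp
    qed
    show "(\<lambda>l. ?F (l + Suc k) - ?F (l + Suc k + Suc i)) sums (\<Sum>j=0..i. ?F (Suc k + j))" for k
      by (rule sums_shift_diff[OF tendsto_inverse_power_nat])
    have "(\<lambda>k. \<Sum>j=0..i. log_coeff m k / real (k + (j + 1)) ^ Suc n) sums (\<Sum>j=0..i. log_sum m n (j + 1))"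
      by (intro sums_sum log_sum_sums)
    then show "(\<lambda>k. log_coeff m k * (\<Sum>j=0..i. ?F (Suc k + j))) sums (\<Sum>j=0..i. log_sum m n (j + 1))"
      by (simp add: sum_distrib_left add_ac)
  qed (rule log_coeff_nonneg)
  moreover have "real l * log_coeff (Suc m) l = (\<Sum>k<l. log_coeff m k)" for l
    by (cases "l = 0") auto
  ultimately show ?thesis by simp
qed

text \<open>Since l (1/l - 1/(l + i + 1)) = (i + 1)/(l + i + 1), the weighted series is itself a
  multiple of \<open>log_sum\<close> when n = 0.\<close>

lemma log_sum_rec_0:
  "real (i + 1) * log_sum (Suc m) 0 (i + 1) = (\<Sum>j=0..i. log_sum m 0 (j + 1))"
proof -
  have "(\<lambda>l. real (i + 1) * (log_coeff (Suc m) l / real (l + (i + 1)) ^ Suc 0))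
          sums (real (i + 1) * log_sum (Suc m) 0 (i + 1))"
    by (intro sums_mult log_sum_sums)
  moreover have "real (i + 1) * (log_coeff (Suc m) l / real (l + (i + 1)) ^ Suc 0)
      = real l * log_coeff (Suc m) l * (1 / real l ^ Suc 0 - 1 / real (l + Suc i) ^ Suc 0)" for l
  proof (cases "l = 0")
    case False
    define C where "C = log_coeff (Suc m) l"
    show ?thesis unfolding C_def[symmetric]
      using False by (simp add: divide_simps)
  qed simp
  ultimately show ?thesis
    using sums_weighted_log_coeff[of m 0 i] by (simp only:) (rule sums_unique2)
qed

text \<open>With q = l + i + 1, writing l = q - (i + 1) gives l (1/l^(n+2) - 1/q^(n+2)) = 1/l^(n+1)
  - 1/q^(n+1) + (i + 1)/q^(n+2). The first term sums to the zeta value.\<close>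

lemma log_sum_rec_Suc:
  "real (i + 1) * log_sum (Suc m) (Suc n) (i + 1)
     = log_sum (Suc m) n (i + 1) - log_sum (Suc m) n 0 + (\<Sum>j=0..i. log_sum m (Suc n) (j + 1))"
proof -
  have "(\<lambda>l. log_coeff (Suc m) l / real (l + (i + 1)) ^ Suc n - log_coeff (Suc m) l / real (l + 0) ^ Suc n
        + real l * log_coeff (Suc m) l * (1 / real l ^ Suc (Suc n) - 1 / real (l + Suc i) ^ Suc (Suc n)))
      sums (log_sum (Suc m) n (i + 1) - log_sum (Suc m) n 0 + (\<Sum>j=0..i. log_sum m (Suc n) (j + 1)))"
    by (intro sums_add sums_diff log_sum_sums sums_weighted_log_coeff)
  moreover have "log_coeff (Suc m) l / real (l + (i + 1)) ^ Suc n - log_coeff (Suc m) l / real (l + 0) ^ Suc n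
        + real l * log_coeff (Suc m) l * (1 / real l ^ Suc (Suc n) - 1 / real (l + Suc i) ^ Suc (Suc n))
      = real (i + 1) * (log_coeff (Suc m) l / real (l + (i + 1)) ^ Suc (Suc n))" for l
  proof (cases "l = 0")
    case False
    define C P where "C = log_coeff (Suc m) l" and "P = real (l + (i + 1)) ^ Suc n"
    have "P \<noteq> 0" by (simp add: P_def)
    have "real (l + Suc i) ^ Suc (Suc n) = P * real (l + (i + 1))"
      by (simp add: P_def)
    moreover have "real l * C * (1 / real l ^ Suc (Suc n)) = C / real l ^ Suc n"
      using False by simp
    moreover have "C / P - real l * C / (P * real (l + (i + 1))) = real (i + 1) * (C / (P * real (l + (i + 1))))"
      using \<open>P \<noteq> 0\<close> by (simp add: divide_simps) (simp add: algebra_simps)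
    ultimately show ?thesis
      unfolding C_def[symmetric] by (simp add: right_diff_distrib P_def mult_ac)
  qed simp
  ultimately have "(\<lambda>l. real (i + 1) * (log_coeff (Suc m) l / real (l + (i + 1)) ^ Suc (Suc n)))
      sums (log_sum (Suc m) n (i + 1) - log_sum (Suc m) n 0 + (\<Sum>j=0..i. log_sum m (Suc n) (j + 1)))"
    by simp
  then show ?thesis
    using sums_unique2 sums_mult[OF log_sum_sums] by blast
qed


section \<open>Power series of the logarithm powers\<close>

lemma summable_log_coeff_power:
  assumes "norm (x::real) < 1"
  shows "summable (\<lambda>l. log_coeff m l * x ^ l)"
proof (rule summable_comparison_test')
  show "summable (\<lambda>l. 4 ^ m * norm x ^ l)"
    using assms by (intro summable_mult summable_geometric) simp
  fix l :: nat
  have "log_coeff m l \<le> 4 ^ m / sqrt (real (l + 1))" by (rule log_coeff_le)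
  also have "\<dots> \<le> 4 ^ m / 1" by (intro divide_left_mono) auto
  finally show "norm (log_coeff m l * x ^ l) \<le> 4 ^ m * norm x ^ l"
    by (simp add: abs_mult power_abs log_coeff_nonneg mult_right_mono)
qed

text \<open>Induction on m: both sides vanish at 0 and have equal derivatives. Multiplication by the
  geometric series 1/(1 - y) forms partial sums of coefficients, which are exactly the coefficients
  of the differentiated series for \<open>Suc m\<close>.\<close>

lemma log_coeff_sums:
  assumes "norm (x::real) < 1"
  shows "(\<lambda>l. log_coeff m l * x ^ l) sums ((- ln (1 - x)) ^ m / fact m)"
  using assms
proof (induction m arbitrary: x)
  case 0
  have "(\<lambda>l. if l = 0 then 1 else 0) sums (1::real)"
    by (rule sums_single[of 0 "\<lambda>_. 1", simplified])
  moreover have "(\<lambda>l. log_coeff 0 l * x ^ l) = (\<lambda>l. if l = 0 then 1 else 0)"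
    by auto
  ultimately show ?case by simp
next
  case (Suc m)
  define B where "B = (\<lambda>x::real. \<Sum>l. log_coeff (Suc m) l * x ^ l)"
  define D where "D = (\<lambda>x::real. B x - (- ln (1 - x)) ^ Suc m / fact (Suc m))"
  have "(D has_field_derivative 0) (at y)" if y: "norm y < 1" for y
  proof -
    have "(\<lambda>l. \<Sum>k\<le>l. log_coeff m k * y ^ k * y ^ (l - k))
            sums ((\<Sum>l. log_coeff m l * y ^ l) * (\<Sum>l. y ^ l))"
    proof (rule Cauchy_product_sums)
      have "summable (\<lambda>l. log_coeff m l * norm y ^ l)"
        using y by (intro summable_log_coeff_power) simp
      then show "summable (\<lambda>l. norm (log_coeff m l * y ^ l))"
        by (simp add: abs_mult power_abs log_coeff_nonneg)
      show "summable (\<lambda>l. norm (y ^ l))"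
        using y by (simp add: power_abs)
    qed
    also have "(\<Sum>l. log_coeff m l * y ^ l) * (\<Sum>l. y ^ l) = (- ln (1 - y)) ^ m / fact m * (1 / (1 - y))"
      using Suc.IH[OF y] y by (simp add: sums_iff suminf_geometric)
    also have "(\<lambda>l. \<Sum>k\<le>l. log_coeff m k * y ^ k * y ^ (l - k))
        = (\<lambda>l. diffs (log_coeff (Suc m)) l * y ^ l)"
    proof
      fix l
      have "(\<Sum>k\<le>l. log_coeff m k * y ^ k * y ^ (l - k)) = (\<Sum>k\<le>l. log_coeff m k * y ^ l)"
        by (intro sum.cong) (auto simp: mult.assoc simp flip: power_add)
      also have "\<dots> = diffs (log_coeff (Suc m)) l * y ^ l"
        by (simp add: diffs_def sum_distrib_right lessThan_Suc_atMost del: of_nat_Suc)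
      finally show "(\<Sum>k\<le>l. log_coeff m k * y ^ k * y ^ (l - k)) = diffs (log_coeff (Suc m)) l * y ^ l" .
    qed
    finally have "(\<Sum>l. diffs (log_coeff (Suc m)) l * y ^ l) = (- ln (1 - y)) ^ m / fact m * (1 / (1 - y))"
      by (simp add: sums_iff)
    moreover have "(B has_field_derivative (\<Sum>l. diffs (log_coeff (Suc m)) l * y ^ l)) (at y)"
      unfolding B_def using y by (intro termdiffs_strong'[where K = 1] summable_log_coeff_power)
    moreover have "((\<lambda>x. (- ln (1 - x)) ^ Suc m / fact (Suc m)) has_field_derivative
        (- ln (1 - y)) ^ m / fact m * (1 / (1 - y))) (at y)"
      using y by (auto intro!: derivative_eq_intros simp: divide_simps simp del: power_Suc of_nat_Suc)
    ultimately show ?thesis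
      unfolding D_def using DERIV_diff by fastforce
  qed
  then have "\<exists>C. \<forall>y\<in>ball 0 1. D y = C"
    by (intro has_field_derivative_zero_constant) (auto intro: DERIV_subset)
  then have "D x = D 0"
    using Suc.prems by force
  moreover have "B 0 = log_coeff (Suc m) 0"
    unfolding B_def by (rule powser_zero)
  then have "D 0 = 0"
    by (simp add: D_def)
  ultimately have "B x = (- ln (1 - x)) ^ Suc m / fact (Suc m)"
    by (simp add: D_def)
  then show ?case
    unfolding B_def using summable_log_coeff_power[OF Suc.prems] by (metis summable_sums)
qed

section \<open>Logarithmic integrals and the series for \<open>S_int\<close>\<close>

lemma tendsto_mult_ln_power_0: "((\<lambda>x::real. x * (- ln x) ^ n) \<longlongrightarrow> 0) (at_right 0)"
proof -
  have "LIM x at_right 0. - ln (x::real) :> at_top"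
    using ln_at_0 by (simp add: filterlim_uminus_at_bot)
  from filterlim_compose[OF tendsto_power_div_exp_0 this]
  have "((\<lambda>x::real. (- ln x) ^ n / exp (- ln x)) \<longlongrightarrow> 0) (at_right 0)" .
  moreover have "eventually (\<lambda>x::real. (- ln x) ^ n / exp (- ln x) = x * (- ln x) ^ n) (at_right 0)"
    using eventually_at_right_less[of "0::real"]
    by eventually_elim (simp add: exp_minus field_simps)
  ultimately show ?thesis
    by (rule Lim_transform_eventually)
qed

text \<open>This supplies the endpoint 0 for the fundamental theorem of calculus: one factor x
  absorbs the logarithm, and \<open>0 ^ Suc k\<close> makes the value there agree with the
  limit.\<close>

lemma continuous_on_power_mult_ln_power:
  "continuous_on {0..1} (\<lambda>x::real. x ^ Suc k * (- ln x) ^ n)"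
proof (rule continuous_on_eq_continuous_within[THEN iffD2], intro ballI)
  fix x :: real assume x: "x \<in> {0..1}"
  show "continuous (at x within {0..1}) (\<lambda>x. x ^ Suc k * (- ln x) ^ n)"
  proof (cases "x = 0")
    case True
    have "((\<lambda>x::real. x ^ k * (x * (- ln x) ^ n)) \<longlongrightarrow> 0 ^ k * 0) (at_right 0)"
      by (intro tendsto_mult tendsto_power tendsto_mult_ln_power_0 tendsto_ident_at)
    then have "((\<lambda>x::real. x ^ Suc k * (- ln x) ^ n) \<longlongrightarrow> 0) (at_right 0)"
      by (simp add: mult_ac)
    then show ?thesis
      using True by (simp add: continuous_within at_within_Icc_at_right)
  next
    case False
    then show ?thesis
      using x by (intro continuous_intros continuous_at_imp_continuous_at_within) auto
  qed
qed

text \<open>Integration by parts as induction on n: the antiderivative x^(k+1) (- ln x)^(n+1) /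
  (n+1)! vanishes at both endpoints, and its derivative combines the integrands for n + 1 and
  n.\<close>

lemma has_integral_power_mult_ln_power:
  "((\<lambda>x::real. x ^ k * ((- ln x) ^ n / fact n)) has_integral 1 / real (k + 1) ^ Suc n) {0..1}"
proof (induction n)
  case 0
  have "((\<lambda>x::real. x ^ k) has_integral (1 ^ Suc k / real (Suc k) - 0 ^ Suc k / real (Suc k))) {0..1}"
    by (intro fundamental_theorem_of_calculus)
       (auto simp flip: has_real_derivative_iff_has_vector_derivative
             intro!: derivative_eq_intros simp del: of_nat_Suc power_Suc)
  then show ?case by simp
next
  case (Suc n)
  let ?f = "\<lambda>n x::real. x ^ k * ((- ln x) ^ n / fact n)"
  have "((\<lambda>x. real (k + 1) * ?f (Suc n) x - ?f n x) has_integral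
          1 ^ Suc k * (- ln 1) ^ Suc n / fact (Suc n) - 0 ^ Suc k * (- ln 0) ^ Suc n / fact (Suc n)) {0..1}"
  proof (rule fundamental_theorem_of_calculus_interior)
    show "continuous_on {0..1} (\<lambda>x::real. x ^ Suc k * (- ln x) ^ Suc n / fact (Suc n))"
      by (intro continuous_intros continuous_on_power_mult_ln_power) auto
    show "((\<lambda>x. x ^ Suc k * (- ln x) ^ Suc n / fact (Suc n)) has_vector_derivative
            real (k + 1) * ?f (Suc n) x - ?f n x) (at x)" if "x \<in> {0<..<1}" for x :: real
    proof -
      have "((\<lambda>x. x ^ Suc k * ((- ln x) ^ Suc n / fact (Suc n))) has_real_derivative
              real (Suc k) * x ^ k * ((- ln x) ^ Suc n / fact (Suc n))
              + (real (Suc n) * (- ln x) ^ n * (- (1 / x)) / fact (Suc n)) * x ^ Suc k) (at x)"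
        using that by (auto intro!: derivative_eq_intros simp: diff_divide_distrib simp del: power_Suc of_nat_Suc fact_Suc)
      also have "real (Suc n) * (- ln x) ^ n * (- (1 / x)) / fact (Suc n) * x ^ Suc k = - ?f n x"
        using that by (simp add: divide_simps del: of_nat_Suc)
      finally show ?thesis
        by (simp add: mult.assoc del: power_Suc fact_Suc of_nat_Suc
            flip: has_real_derivative_iff_has_vector_derivative)
    qed
  qed simp
  then have "((\<lambda>x. real (k + 1) * ?f (Suc n) x - ?f n x) has_integral 0) {0..1}"
    by simp
  from has_integral_divide[OF has_integral_add[OF this Suc.IH], of "real (k + 1)"]
  show ?case by (simp add: mult_ac)
qed

text \<open>The signs make both logarithms nonnegative, so the partial sums of the series increase
  and monotone convergence permits termwise integration. The open interval keeps x where
  \<open>log_coeff_sums\<close> applies.\<close>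

lemma S_int_eq_log_sum: "S_int n m i = log_sum m n (i + 1)"
proof -
  let ?g = "\<lambda>x::real. x ^ i * ((- ln x) ^ n / fact n) * ((- ln (1 - x)) ^ m / fact m)"
  let ?f = "\<lambda>N x::real. \<Sum>l<N. log_coeff m l * (x ^ (l + i) * ((- ln x) ^ n / fact n))"
  have "(?g has_integral log_sum m n (i + 1)) {0<..<1}"
  proof (rule has_integral_monotone_convergence_increasing)
    show "(?f N has_integral (\<Sum>l<N. log_coeff m l * (1 / real (l + i + 1) ^ Suc n))) {0<..<1}" for N
      unfolding has_integral_Icc_iff_Ioo[symmetric]
      by (intro has_integral_sum has_integral_mult_right has_integral_power_mult_ln_power) auto
    show "?f N x \<le> ?f (Suc N) x" if "x \<in> {0<..<1}" for N and x :: real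
      using that by (simp add: log_coeff_nonneg)
    show "(\<lambda>N. ?f N x) \<longlonglongrightarrow> ?g x" if "x \<in> {0<..<1}" for x :: real
    proof -
      have "(\<lambda>l. x ^ i * ((- ln x) ^ n / fact n) * (log_coeff m l * x ^ l)) sums ?g x"
        using that by (intro sums_mult log_coeff_sums) auto
      then show ?thesis
        by (simp add: sums_def power_add mult_ac)
    qed
    show "(\<lambda>N. \<Sum>l<N. log_coeff m l * (1 / real (l + i + 1) ^ Suc n)) \<longlonglongrightarrow> log_sum m n (i + 1)"
      using log_sum_sums[of m "i + 1" n] by (simp add: sums_def add_ac)
  qed
  then have "integral {0..1} ?g = log_sum m n (i + 1)"
    unfolding has_integral_Icc_iff_Ioo[symmetric] by (rule integral_unique)
  moreover have "?g = (\<lambda>x. (-1) ^ (n + m) / (fact n * fact m) * (x ^ i * ln x ^ n * ln (1 - x) ^ m))"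
    by (simp add: fun_eq_iff power_minus[of "ln _"] power_add mult_ac)
  ultimately show ?thesis
    unfolding S_int_def by (simp only: integral_mult_right)
qed

section \<open>Weakly decreasing lists and harmonic star sums\<close>

lemma finite_weak_decr: "finite (weak_decr lo hi k)"
  by (rule finite_subset[OF _ finite_lists_length_eq[of "{lo..hi}" k]]) (auto simp: weak_decr_def)

lemma weak_decr_0: "weak_decr lo hi 0 = {[]}"
  by (auto simp: weak_decr_def)

text \<open>The head is the maximum of the list and so becomes the upper bound for the tail; sums
  over such lists thereby become nested sums.\<close>

lemma weak_decr_Suc:
  "weak_decr lo hi (Suc k) = (\<lambda>(a, as). a # as) ` Sigma {lo..hi} (\<lambda>a. weak_decr lo a k)"
proof (intro equalityI subsetI)
  fix xs assume "xs \<in> weak_decr lo hi (Suc k)"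
  then obtain a as where "xs = a # as" "a \<in> {lo..hi}" "as \<in> weak_decr lo a k"
    by (cases xs) (auto simp: weak_decr_def subset_iff)
  then show "xs \<in> (\<lambda>(a, as). a # as) ` Sigma {lo..hi} (\<lambda>a. weak_decr lo a k)"
    by auto
next
  fix xs assume "xs \<in> (\<lambda>(a, as). a # as) ` Sigma {lo..hi} (\<lambda>a. weak_decr lo a k)"
  then obtain a as where "xs = a # as" "a \<in> {lo..hi}" "as \<in> weak_decr lo a k"
    by auto
  then show "xs \<in> weak_decr lo hi (Suc k)"
    by (auto simp: weak_decr_def subset_iff)
qed

lemma sum_weak_decr_Suc:
  "(\<Sum>xs\<in>weak_decr lo hi (Suc k). f xs) = (\<Sum>a=lo..hi. \<Sum>as\<in>weak_decr lo a k. f (a # as))"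
  unfolding weak_decr_Suc
  by (subst sum.reindex) (auto simp: inj_on_def sum.Sigma finite_weak_decr o_def case_prod_unfold)

lemma zeta_star_ones_0: "zeta_star_ones N 0 = 1"
  by (simp add: zeta_star_ones_def weak_decr_0)

lemma zeta_star_ones_Suc: "zeta_star_ones N (Suc k) = (\<Sum>a=1..N. zeta_star_ones a k / real a)"
  unfolding zeta_star_ones_def sum_weak_decr_Suc
  by (simp add: prod.lessThan_Suc_shift sum_divide_distrib mult_ac del: prod.lessThan_Suc)

lemma log_sum_0: "log_sum 0 n q = 1 / real q ^ Suc n"
proof -
  have "(\<lambda>l. if l = 0 then 1 / real q ^ Suc n else 0) sums (1 / real q ^ Suc n)"
    using sums_single[of 0 "\<lambda>_. 1 / real q ^ Suc n"] .
  moreover have "(\<lambda>l. if l = 0 then 1 / real q ^ Suc n else 0)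
      = (\<lambda>l. log_coeff 0 l / real (l + q) ^ Suc n)"
    by auto
  ultimately show ?thesis
    using log_sum_sums[of 0 q n] sums_unique2 by metis
qed

text \<open>After the shift a = j + 1, \<open>log_sum_rec_0\<close> and
  \<open>zeta_star_ones_Suc\<close> are the same recursion in m.\<close>

lemma log_sum_eq_zeta_star_ones: "log_sum m 0 (i + 1) = zeta_star_ones (i + 1) m / real (i + 1)"
proof (induction m arbitrary: i)
  case 0
  show ?case by (simp add: log_sum_0 zeta_star_ones_0)
next
  case (Suc m)
  have "(\<Sum>j=0..i. log_sum m 0 (j + 1)) = (\<Sum>j=0..i. zeta_star_ones (j + 1) m / real (j + 1))"
    by (simp only: Suc)
  also have "\<dots> = zeta_star_ones (i + 1) (Suc m)"
    using sum.shift_bounds_cl_nat_ivl[of "\<lambda>a. zeta_star_ones a m / real a" 0 1 i]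
    by (simp add: zeta_star_ones_Suc)
  finally show ?case
    using log_sum_rec_0[of i m] by (simp add: field_simps)
qed

section \<open>Multiple zeta values as \<open>log_sum\<close> with shift 0\<close>

text \<open>The general set A covers both the infinite index range of \<open>multi_zeta\<close> and
  the finite ranges left for the tail once the head is fixed.\<close>

definition strict_decr :: "nat set \<Rightarrow> nat \<Rightarrow> nat list set" where
  "strict_decr A k = {ls. length ls = k \<and> sorted_wrt (>) ls \<and> set ls \<subseteq> A}"

lemma finite_strict_decr: "finite A \<Longrightarrow> finite (strict_decr A k)"
  by (rule finite_subset[OF _ finite_lists_length_eq[of A k]]) (auto simp: strict_decr_def)

lemma strict_decr_0: "strict_decr A 0 = {[]}"
  by (auto simp: strict_decr_def)

text \<open>The assumptions say that A is an initial segment of the positive integers, so below the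
  head a the tail ranges over all of \<open>{1..<a}\<close>.\<close>

lemma strict_decr_Suc:
  assumes "A \<subseteq> {1..}" and "\<And>a. a \<in> A \<Longrightarrow> {1..<a} \<subseteq> A"
  shows "strict_decr A (Suc k) = (\<lambda>(a, as). a # as) ` Sigma A (\<lambda>a. strict_decr {1..<a} k)"
proof (intro equalityI subsetI)
  fix xs assume "xs \<in> strict_decr A (Suc k)"
  then obtain a as where "xs = a # as" "a \<in> A" "as \<in> strict_decr {1..<a} k"
    using assms(1) by (cases xs) (auto simp: strict_decr_def subset_iff)
  then show "xs \<in> (\<lambda>(a, as). a # as) ` Sigma A (\<lambda>a. strict_decr {1..<a} k)"
    by auto
next
  fix xs assume "xs \<in> (\<lambda>(a, as). a # as) ` Sigma A (\<lambda>a. strict_decr {1..<a} k)"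
  then obtain a as where "xs = a # as" "a \<in> A" "as \<in> strict_decr {1..<a} k"
    by auto
  then show "xs \<in> strict_decr A (Suc k)"
    using assms(2)[of a] by (auto simp: strict_decr_def subset_iff)
qed

text \<open>Fixing the largest entry reproduces the recursion of \<open>log_coeff\<close>.
  Positivity of l enters for p = 0, where the right-hand side needs its term at 0; in the induction
  step the term at 0 vanishes.\<close>

lemma sum_strict_decr_eq_log_coeff:
  "l > 0 \<Longrightarrow> (\<Sum>ls\<in>strict_decr {1..<l} p. \<Prod>k<p. 1 / real (ls ! k)) = (\<Sum>k<l. log_coeff p k)"
proof (induction p arbitrary: l)
  case 0
  then show ?case by (simp add: strict_decr_0)
next
  case (Suc p)
  have "strict_decr {1..<l} (Suc p) = (\<lambda>(a, as). a # as) ` Sigma {1..<l} (\<lambda>a. strict_decr {1..<a} p)"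
    by (rule strict_decr_Suc) auto
  then have "(\<Sum>ls\<in>strict_decr {1..<l} (Suc p). \<Prod>k<Suc p. 1 / real (ls ! k))
      = (\<Sum>a\<in>{1..<l}. \<Sum>as\<in>strict_decr {1..<a} p. \<Prod>k<Suc p. 1 / real ((a # as) ! k))"
    by (simp only:, subst sum.reindex)
       (auto simp: inj_on_def sum.Sigma finite_strict_decr o_def case_prod_unfold)
  also have "\<dots> = (\<Sum>a\<in>{1..<l}. (\<Sum>as\<in>strict_decr {1..<a} p. \<Prod>k<p. 1 / real (as ! k)) / real a)"
    by (simp add: prod.lessThan_Suc_shift sum_divide_distrib del: prod.lessThan_Suc)
  also have "\<dots> = (\<Sum>a\<in>{1..<l}. log_coeff (Suc p) a)"
    by (intro sum.cong refl) (simp add: Suc.IH[simplified])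
  also have "\<dots> = (\<Sum>a<l. log_coeff (Suc p) a)"
    by (intro sum.mono_neutral_left) (auto simp: not_le)
  finally show ?case .
qed

text \<open>For a fixed largest index l the remaining sum is l times
  \<open>log_coeff (Suc p) l\<close>, which lowers the exponent of l by one. Nonnegativity turns the
  iterated sum into the sum over all lists.\<close>

lemma multi_zeta_eq_log_sum: "multi_zeta (Suc (Suc n) # replicate p 1) = log_sum (Suc p) n 0"
proof -
  let ?D = "\<lambda>l. strict_decr {1..<l} p"
  let ?f = "\<lambda>(l, ls). 1 / real l ^ Suc (Suc n) * (\<Prod>k<p. 1 / real (ls ! k))"
  let ?g = "\<lambda>ls. \<Prod>k<Suc p. 1 / real (ls ! k) ^ ((Suc (Suc n) # replicate p 1) ! k)"
  have inner: "((\<lambda>ls. ?f (l, ls)) has_sum log_coeff (Suc p) l / real l ^ Suc n) (?D l)"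
    if "l \<in> {1..}" for l
  proof (rule has_sum_finiteI[OF finite_strict_decr])
    have "log_coeff (Suc p) l = (\<Sum>ls\<in>?D l. \<Prod>k<p. 1 / real (ls ! k)) / real l"
      using that by (subst sum_strict_decr_eq_log_coeff) auto
    then show "log_coeff (Suc p) l / real l ^ Suc n = (\<Sum>ls\<in>?D l. ?f (l, ls))"
      by (simp add: mult_ac sum_divide_distrib del: log_coeff.simps)
  qed simp
  have "((\<lambda>l. log_coeff (Suc p) l / real l ^ Suc n) has_sum log_sum (Suc p) n 0) UNIV"
    using log_sum_sums[of "Suc p" 0 n]
    by (intro sums_nonneg_imp_has_sum)
       (auto intro: divide_nonneg_nonneg log_coeff_nonneg simp del: log_coeff.simps)
  also have "?this \<longleftrightarrow> ((\<lambda>l. log_coeff (Suc p) l / real l ^ Suc n) has_sum log_sum (Suc p) n 0) {1..}"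
    by (intro has_sum_cong_neutral) (auto simp: not_le)
  finally have outer: "((\<lambda>l. log_coeff (Suc p) l / real l ^ Suc n) has_sum log_sum (Suc p) n 0) {1..}" .
  have "(?f has_sum log_sum (Suc p) n 0) (Sigma {1..} ?D)"
  proof (rule has_sum_SigmaI[OF inner outer])
    show "?f summable_on Sigma {1..} ?D"
      by (rule summable_on_SigmaI[OF inner has_sum_imp_summable[OF outer]])
         (auto intro!: mult_nonneg_nonneg divide_nonneg_nonneg prod_nonneg)
  qed
  also have "?f = ?g \<circ> (\<lambda>(l, ls). l # ls)"
    by (auto simp: fun_eq_iff prod.lessThan_Suc_shift simp del: prod.lessThan_Suc)
  finally have "(?g has_sum log_sum (Suc p) n 0) ((\<lambda>(l, ls). l # ls) ` Sigma {1..} ?D)"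
    by (rule has_sum_reindex[THEN iffD2, rotated]) (auto simp: inj_on_def)
  also have "(\<lambda>(l, ls). l # ls) ` Sigma {1..} ?D = strict_decr {1..} (Suc p)"
    by (rule strict_decr_Suc[symmetric]) auto
  finally show ?thesis
    unfolding multi_zeta_def strict_decr_def by (simp only: infsumI length_Cons length_replicate)
qed

section \<open>Solving the recurrence in n and iterating in m\<close>

text \<open>Such sums arise from solving q x(n+1) = x(n) + f(n+1); this is one step of that
  solution, applied both to the zeta values in \<open>t_coeff\<close> and to the sums of lower
  depth.\<close>

lemma sum_divide_power_Suc:
  fixes f :: "nat \<Rightarrow> real"
  shows "(\<Sum>s=1..Suc n. f s / q ^ (Suc n + 1 - s)) = ((\<Sum>s=1..n. f s / q ^ (n + 1 - s)) + f (Suc n)) / q"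
proof -
  have "(\<Sum>s=1..n. f s / q ^ (Suc n + 1 - s)) = (\<Sum>s=1..n. f s / q ^ (n + 1 - s) / q)"
    by (intro sum.cong) (auto simp: Suc_diff_le)
  then show ?thesis by (simp add: sum_divide_distrib add_divide_distrib)
qed

text \<open>This is the recurrence of \<open>log_sum_rec_Suc\<close> without its sum over j.\<close>

lemma t_coeff_Suc:
  "t_coeff (Suc n) (Suc p) i = (t_coeff n (Suc p) i - log_sum (Suc p) n 0) / real (i + 1)"
  unfolding t_coeff_def sum_divide_power_Suc
  by (simp add: multi_zeta_eq_log_sum[simplified] diff_divide_distrib add_divide_distrib)

text \<open>Both sides obey \<open>log_sum_rec_Suc\<close> in n and agree at n = 0 by
  \<open>log_sum_eq_zeta_star_ones\<close>.\<close>

lemma log_sum_eq_t_coeff_add: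
  "log_sum (Suc m) n (i + 1)
     = t_coeff n (Suc m) i + (\<Sum>r=1..n. \<Sum>j=0..i. log_sum m r (j + 1) / real (i + 1) ^ (n + 1 - r))"
proof (induction n)
  case 0
  show ?case by (simp only: log_sum_eq_zeta_star_ones) (simp add: t_coeff_def)
next
  case (Suc n)
  have "log_sum (Suc m) (Suc n) (i + 1) = (log_sum (Suc m) n (i + 1) - log_sum (Suc m) n 0
      + (\<Sum>j=0..i. log_sum m (Suc n) (j + 1))) / real (i + 1)"
    using log_sum_rec_Suc[of i m n] by (simp add: field_simps)
  then show ?case
    unfolding sum_divide_distrib[symmetric] sum_divide_power_Suc t_coeff_Suc Suc.IH
    by (simp add: add_divide_distrib diff_divide_distrib)
qed

text \<open>The parameter f is the factor at the end of the chain, so both multiple sums of the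
  theorem are instances; n and i are the initial entries r_0 and j_0.\<close>

definition chain_sum :: "(nat \<Rightarrow> nat \<Rightarrow> real) \<Rightarrow> nat \<Rightarrow> nat \<Rightarrow> nat \<Rightarrow> real" where
  "chain_sum f h n i = (\<Sum>rs\<in>weak_decr 1 n h. \<Sum>js\<in>weak_decr 0 i h.
     f ((n # rs) ! h) ((i # js) ! h) / chain_prod (n # rs) (i # js) h)"

lemma chain_sum_0: "chain_sum f 0 n i = f n i"
  by (simp add: chain_sum_def weak_decr_0 chain_prod_def)

lemma chain_prod_Cons_Suc:
  "chain_prod (n # r # rs) (i # j # js) (Suc h)
     = real (i + 1) ^ (n + 1 - r) * chain_prod (r # rs) (j # js) h"
  by (simp add: chain_prod_def prod.lessThan_Suc_shift del: prod.lessThan_Suc)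

text \<open>Splitting off (r_1, j_1) removes the factor k = 0 of \<open>chain_prod\<close> and
  leaves a chain of length h that starts at (r_1, j_1).\<close>

lemma chain_sum_Suc:
  "chain_sum f (Suc h) n i = (\<Sum>r=1..n. \<Sum>j=0..i. chain_sum f h r j / real (i + 1) ^ (n + 1 - r))"
proof -
  have "chain_sum f (Suc h) n i = (\<Sum>r=1..n. \<Sum>rs\<in>weak_decr 1 r h. \<Sum>j=0..i. \<Sum>js\<in>weak_decr 0 j h.
     f ((r # rs) ! h) ((j # js) ! h) / chain_prod (r # rs) (j # js) h / real (i + 1) ^ (n + 1 - r))"
    unfolding chain_sum_def sum_weak_decr_Suc chain_prod_Cons_Suc nth_Cons_Suc
    by (simp add: mult_ac)
  also have "\<dots> = (\<Sum>r=1..n. \<Sum>j=0..i. \<Sum>rs\<in>weak_decr 1 r h. \<Sum>js\<in>weak_decr 0 j h.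
     f ((r # rs) ! h) ((j # js) ! h) / chain_prod (r # rs) (j # js) h / real (i + 1) ^ (n + 1 - r))"
    by (intro sum.cong refl sum.swap)
  finally show ?thesis
    unfolding chain_sum_def sum_divide_distrib .
qed

text \<open>In \<open>log_sum_eq_t_coeff_add\<close> the \<open>t_coeff\<close> term is the chain of
  length 0, and the double sum puts a new first step before every chain for m. This raises h by one
  and keeps m - h = Suc m - Suc h; the depth-0 value \<open>log_sum_0\<close> ends the full
  chains.\<close>

lemma log_sum_eq_chain_sum:
  "log_sum m n (i + 1) = (\<Sum>h<m. chain_sum (\<lambda>r j. t_coeff r (m - h) j) h n i)
     + chain_sum (\<lambda>r j. 1 / real (j + 1) ^ (r + 1)) m n i"
proof (induction m arbitrary: n i)
  case 0
  show ?case by (simp add: log_sum_0 chain_sum_0)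
next
  case (Suc m)
  have "(\<Sum>r=1..n. \<Sum>j=0..i. log_sum m r (j + 1) / real (i + 1) ^ (n + 1 - r))
      = (\<Sum>r=1..n. \<Sum>j=0..i. \<Sum>h<m. chain_sum (\<lambda>r j. t_coeff r (m - h) j) h r j / real (i + 1) ^ (n + 1 - r))
        + chain_sum (\<lambda>r j. 1 / real (j + 1) ^ (r + 1)) (Suc m) n i"
    unfolding Suc.IH chain_sum_Suc
    by (simp only: add_divide_distrib sum.distrib sum_divide_distrib)
  also have "(\<Sum>r=1..n. \<Sum>j=0..i. \<Sum>h<m. chain_sum (\<lambda>r j. t_coeff r (m - h) j) h r j / real (i + 1) ^ (n + 1 - r))
      = (\<Sum>h<m. chain_sum (\<lambda>r j. t_coeff r (Suc m - Suc h) j) (Suc h) n i)"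
    unfolding chain_sum_Suc diff_Suc_Suc
    \<comment> \<open>Two exchanges carry the sum over h from the innermost to the outermost
      position.\<close>
    by (subst (2) sum.swap, subst sum.swap) (rule refl)
  finally show ?case
    unfolding log_sum_eq_t_coeff_add sum.lessThan_Suc_shift chain_sum_0 by simp
qed

theorem theorem2p14:
  fixes n m i :: nat
  assumes "n \<ge> 1" and "m \<ge> 1"
  shows "S_int n m i =
    (\<Sum>h=1..m-1. \<Sum>rs\<in>weak_decr 1 n h. \<Sum>js\<in>weak_decr 0 i h.
       t_coeff ((n # rs) ! h) (m - h) ((i # js) ! h) / chain_prod (n # rs) (i # js) h)
    + (\<Sum>rs\<in>weak_decr 1 n m. \<Sum>js\<in>weak_decr 0 i m.
       1 / (chain_prod (n # rs) (i # js) m * real ((i # js) ! m + 1) ^ ((n # rs) ! m + 1)))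
    + t_coeff n m i"
proof -
  \<comment> \<open>The term h = 0 is the isolated \<open>t_coeff n m i\<close>.\<close>
  have "{..<m} = insert 0 {1..m-1}"
    using assms(2) by auto
  then have "S_int n m i = (\<Sum>h=1..m-1. chain_sum (\<lambda>r j. t_coeff r (m - h) j) h n i)
      + chain_sum (\<lambda>r j. 1 / real (j + 1) ^ (r + 1)) m n i + t_coeff n m i"
    unfolding S_int_eq_log_sum log_sum_eq_chain_sum by (simp add: chain_sum_0)
  then show ?thesis
    unfolding chain_sum_def by (simp add: mult_ac)
qed

end
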